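(* Let $\mathbb{K}$ be a field of characteristic zero, let $\mathcal{A}$ be a central arrangement of lines in $\mathbb{K}^2$ with $|\mathcal{A}|=h>2$, and let $m_0:\mathcal{A}\rightarrow\mathbb{Z}_{>0}$ be a balanced multiplicity such that $\Delta(m_0)=h-2$. Assume that one of the following two holds: (1) $|\mathcal{A}|=h=3$ and $m_0-1$ is balanced, or (2) $|\mathcal{A}|=h\ge 4$. Let $\theta_0$ be the lower degree basis for $D(\mathcal{A},m_0)$. Then for every $m:\mathcal{A}\rightarrow\{+1,0\}$, the map $$\Phi_0:D(\mathcal{A},m)\rightarrow D(\mathcal{A},m_0+m-1),\qquad \Phi_0(\theta):=\nabla_\theta\theta_0,$$ is well defined and is an isomorphism of $S$-modules.
   Context: Let $V=\mathbb{K}^2$, $S=\mathbb{K}[x_1,x_2]$, $\mathrm{Der}(S)=S\partial_{x_1}\oplus S\partial_{x_2}$. For a finite set $\mathcal{A}$ of lines through the origin in $V$, fix for each $H\in\mathcal{A}$ a linear form $\alpha_H\in V^*$ with $\ker\alpha_H=H$. For $m:\mathcal{A}\to\mathbb{Z}_{\ge0}$ put $$D(\mathcal{A},m)=\{\theta\in\mathrm{Der}(S)\mid \theta(\alpha_H)\in S\cdot\alpha_H^{m(H)}\ \text{for all } H\in\mathcal{A}\}$$ (so $m(H)=0$ imposes no condition at $H$). A nonzero derivation $\theta=f_1\partial_{x_1}+f_2\partial_{x_2}$ is homogeneous of degree $d$ if $f_1,f_2$ are each zero or homogeneous polynomials of degree $d$. In dimension two $D(\mathcal{A},m)$ is always a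 free $S$-module of rank $2$; if $\theta_1,\theta_2$ is a homogeneous basis, $\exp(\mathcal{A},m)=(d_1,d_2)=(\deg\theta_1,\deg\theta_2)$ and $\Delta(m)=|d_1-d_2|$. A multiplicity $m$ (values in $\mathbb{Z}_{\ge0}$) is balanced if $m(K)\le\sum_{H\in\mathcal{A}\setminus\{K\}}m(H)$ for every $K\in\mathcal{A}$. The multiplicity $m_0-1$ is $H\mapsto m_0(H)-1$, and $m_0+m-1$ is $H\mapsto m_0(H)+m(H)-1$. The lower degree basis for $D(\mathcal{A},m)$ is a homogeneous derivation $\theta$ for which there is a homogeneous $\varphi$ such that $\{\theta,\varphi\}$ is an $S$-basis of $D(\mathcal{A},m)$ and $\deg\theta\le\deg\varphi$ (unique up to a nonzero scalar when $\Delta(m)>0$). The affine connection $\nabla$ is defined by $\nabla_\theta\left(f_1\partial_{x_1}+f_2\partial_{x_2}\right)=\theta(f_1)\partial_{x_1}+\theta(f_2)\partial_{x_2}$. *)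

theory Defs
  imports "HOL-Analysis.Analysis" "HOL-Computational_Algebra.Polynomial"
begin

text \<open>
  The polynomial ring \<open>S = K[x1, x2]\<close> is rendered as \<open>K[x1][x2]\<close>, i.e. as the type
  \<open>'a poly poly\<close>: the inner variable is \<open>x1 = [:[:0, 1:]:]\<close>, the outer variable is
  \<open>x2 = [:0, 1:]\<close>, and \<open>coeff (coeff f j) i\<close> is the coefficient of \<open>x1 ^ i * x2 ^ j\<close> in \<open>f\<close>.
  The free module \<open>Der(S)\<close> is rendered as \<open>S\<^sup>2\<close>: the vector \<open>\<theta>\<close> stands for the derivation
  with coefficient \<open>\<theta> $ 1\<close> at \<open>\<partial>/\<partial>x1\<close> and \<open>\<theta> $ 2\<close> at \<open>\<partial>/\<partial>x2\<close>.
\<close>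

type_synonym 'a S = "'a poly poly"
type_synonym 'a Der = "('a poly poly) ^ 2"

interpretation der: module "(*s) :: 'a::comm_ring_1 S \<Rightarrow> 'a Der \<Rightarrow> 'a Der"
  by unfold_locales (vector algebra_simps)+

definition d1 :: "'a::field_char_0 S \<Rightarrow> 'a S" where
  "d1 f = map_poly pderiv f"

definition d2 :: "'a::field_char_0 S \<Rightarrow> 'a S" where
  "d2 f = pderiv f"

definition der_app :: "'a::field_char_0 Der \<Rightarrow> 'a S \<Rightarrow> 'a S" where
  "der_app \<theta> f = \<theta> $ 1 * d1 f + \<theta> $ 2 * d2 f"

definition nabla :: "'a::field_char_0 Der \<Rightarrow> 'a Der \<Rightarrow> 'a Der" where
  "nabla \<theta> \<eta> = (\<chi> i. der_app \<theta> (\<eta> $ i))"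

text \<open>The zero polynomial satisfies \<open>homogeneous_poly d\<close> for every \<open>d\<close>.\<close>

definition homogeneous_poly :: "nat \<Rightarrow> 'a::zero S \<Rightarrow> bool" where
  "homogeneous_poly d f \<longleftrightarrow> (\<forall>i j. coeff (coeff f j) i \<noteq> 0 \<longrightarrow> i + j = d)"

definition homogeneous_der :: "nat \<Rightarrow> 'a::zero Der \<Rightarrow> bool" where
  "homogeneous_der d \<theta> \<longleftrightarrow> \<theta> \<noteq> 0 \<and> (\<forall>i. homogeneous_poly d (\<theta> $ i))"

definition central_arrangement :: "('a::field ^ 2) set set \<Rightarrow> bool" where
  "central_arrangement A \<longleftrightarrow> finite A \<and> (\<forall>H\<in>A. vec.subspace H \<and> vec.dim H = 1)"

definition defining_forms ::
    "('a::field ^ 2) set set \<Rightarrow> (('a ^ 2) set \<Rightarrow> 'a ^ 2 \<Rightarrow> 'a) \<Rightarrow> bool" where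
  "defining_forms A \<alpha> \<longleftrightarrow>
     (\<forall>H\<in>A. Vector_Spaces.linear (*s) (*) (\<alpha> H) \<and> {v. \<alpha> H v = 0} = H)"

text \<open>The linear form \<open>a\<close> on \<open>K\<^sup>2\<close> as the element \<open>a(e1) x1 + a(e2) x2\<close> of \<open>S\<close>.\<close>

definition form_poly :: "('a::field ^ 2 \<Rightarrow> 'a) \<Rightarrow> 'a S" where
  "form_poly a = [:[:0, a (axis 1 1):], [:a (axis 2 1):]:]"

text \<open>In the following, \<open>\<alpha>\<close> is the chosen family of defining forms. A multiplicity is a function
  on all sets of vectors, of which only the values on the arrangement matter.\<close>

definition D :: "('a::field_char_0 ^ 2) set set \<Rightarrow> (('a ^ 2) set \<Rightarrow> 'a ^ 2 \<Rightarrow> 'a) \<Rightarrow>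
    (('a ^ 2) set \<Rightarrow> nat) \<Rightarrow> 'a Der set" where
  "D A \<alpha> m = {\<theta>. \<forall>H\<in>A. form_poly (\<alpha> H) ^ m H dvd der_app \<theta> (form_poly (\<alpha> H))}"

definition is_basis :: "'a::field_char_0 Der set \<Rightarrow> 'a Der \<Rightarrow> 'a Der \<Rightarrow> bool" where
  "is_basis M \<theta> \<phi> \<longleftrightarrow>
     \<theta> \<noteq> \<phi> \<and> \<not> der.dependent {\<theta>, \<phi>} \<and> der.span {\<theta>, \<phi>} = M"

definition exponents :: "('a::field_char_0 ^ 2) set set \<Rightarrow> (('a ^ 2) set \<Rightarrow> 'a ^ 2 \<Rightarrow> 'a) \<Rightarrow>
    (('a ^ 2) set \<Rightarrow> nat) \<Rightarrow> nat \<Rightarrow> nat \<Rightarrow> bool" where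
  "exponents A \<alpha> m a b \<longleftrightarrow>
     (\<exists>\<theta> \<phi>. is_basis (D A \<alpha> m) \<theta> \<phi> \<and> homogeneous_der a \<theta> \<and> homogeneous_der b \<phi>)"

text \<open>The exponents of a multiarrangement in the plane exist and are unique up to order, so the
  description below determines the value.\<close>

definition Delta :: "('a::field_char_0 ^ 2) set set \<Rightarrow> (('a ^ 2) set \<Rightarrow> 'a ^ 2 \<Rightarrow> 'a) \<Rightarrow>
    (('a ^ 2) set \<Rightarrow> nat) \<Rightarrow> int" where
  "Delta A \<alpha> m = (THE k. \<exists>a b. exponents A \<alpha> m a b \<and> k = \<bar>int a - int b\<bar>)"

definition lower_degree_basis :: "('a::field_char_0 ^ 2) set set \<Rightarrow>
    (('a ^ 2) set \<Rightarrow> 'a ^ 2 \<Rightarrow> 'a) \<Rightarrow> (('a ^ 2) set \<Rightarrow> nat) \<Rightarrow> 'a Der \<Rightarrow> bool" where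
  "lower_degree_basis A \<alpha> m \<theta> \<longleftrightarrow>
     (\<exists>\<phi> a b. is_basis (D A \<alpha> m) \<theta> \<phi> \<and> homogeneous_der a \<theta> \<and> homogeneous_der b \<phi> \<and> a \<le> b)"

definition balanced :: "'h set \<Rightarrow> ('h \<Rightarrow> nat) \<Rightarrow> bool" where
  "balanced A m \<longleftrightarrow> (\<forall>K\<in>A. m K \<le> (\<Sum>H\<in>A - {K}. m H))"

text \<open>Isomorphism between two submodules of \<open>Der(S)\<close>; that \<open>F\<close> maps \<open>M\<close> into \<open>N\<close> is part of
  \<open>bij_betw\<close>.\<close>

definition S_module_iso ::
    "'a::field_char_0 Der set \<Rightarrow> 'a Der set \<Rightarrow> ('a Der \<Rightarrow> 'a Der) \<Rightarrow> bool" where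
  "S_module_iso M N F \<longleftrightarrow> der.subspace M \<and> der.subspace N \<and> bij_betw F M N \<and>
     (\<forall>\<theta>\<in>M. \<forall>\<eta>\<in>M. F (\<theta> + \<eta>) = F \<theta> + F \<eta>) \<and>
     (\<forall>f. \<forall>\<theta>\<in>M. F (f *s \<theta>) = f *s F \<theta>)"

end

theory Submission
  imports Defs "HOL-Computational_Algebra.Polynomial_Factorial"
begin

text \<open>
  By Saito's criterion the exponents \<open>a \<le> b\<close> of \<open>m0\<close> add up to \<open>|m0|\<close>, so \<open>2 a = |m0| - (h - 2)\<close>
  and the Jacobian determinant \<open>J\<close> of the coefficients of \<open>\<theta>0\<close> has degree \<open>2 (a - 1) = |m0 - 1|\<close>.
  It is a multiple of the product of the \<open>\<alpha>\<^sub>H ^ (m0 H - 1)\<close>, hence a scalar multiple of it. If \<open>J\<close>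
  vanished, the two coefficients of \<open>\<theta>0\<close>, being homogeneous of the same degree, would be
  proportional, \<open>\<theta>0 = p v\<close> with a constant vector \<open>v\<close>; then \<open>\<alpha>\<^sub>H ^ m0 H\<close> would divide \<open>p\<close> for all \<open>H\<close>
  but possibly one, and balancedness would give \<open>2 a \<ge> |m0|\<close>. So \<open>J\<close> is a nonzero scalar multiple of
  the product, and Cramer's rule inverts \<open>\<theta> \<mapsto> \<nabla>\<^sub>\<theta> \<theta>0\<close>.

  Degrees are handled through the Euler operator \<open>E = x1 \<partial>/\<partial>x1 + x2 \<partial>/\<partial>x2\<close>, a derivation with \<open>E f = d f\<close>
  iff \<open>f\<close> is homogeneous of degree \<open>d\<close>.
\<close>

subsection \<open>Homogeneous polynomials and the Euler operator\<close>

lemma coeff_d1: "coeff (coeff (d1 f) j) i = of_nat (Suc i) * coeff (coeff f j) (Suc i)"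
  by (simp add: d1_def coeff_map_poly coeff_pderiv)

lemma coeff_d2: "coeff (coeff (d2 f) j) i = of_nat (Suc j) * coeff (coeff f (Suc j)) i"
  by (simp add: d2_def coeff_pderiv of_nat_poly)

lemma d1_add [simp]: "d1 (f + g) = d1 f + d1 g"
  by (simp add: poly_eq_iff coeff_d1 algebra_simps)

lemma d2_add [simp]: "d2 (f + g) = d2 f + d2 g"
  by (simp add: d2_def pderiv_add)

lemma d1_mult: "d1 (f * g) = d1 f * g + f * d1 g"
proof (rule poly_eqI)
  fix n
  show "coeff (d1 (f * g)) n = coeff (d1 f * g + f * d1 g) n"
    by (simp add: d1_def coeff_map_poly coeff_mult higher_pderiv_sum[of 1, simplified]
        pderiv_mult sum.distrib)
       (simp add: algebra_simps)
qed

lemma d2_mult: "d2 (f * g) = d2 f * g + f * d2 g"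
  by (simp add: d2_def pderiv_mult algebra_simps)

definition euler :: "'a::field_char_0 S \<Rightarrow> 'a S" where
  "euler f = [:[:0, 1:]:] * d1 f + [:0, 1:] * d2 f"

lemma coeff_euler: "coeff (coeff (euler f) j) i = of_nat (i + j) * coeff (coeff f j) i"
proof -
  have "coeff (coeff ([:[:0, 1:]:] * d1 f) j) i = of_nat i * coeff (coeff f j) i"
    by (cases i) (simp_all add: coeff_pCons coeff_d1)
  moreover have "coeff (coeff ([:0, 1:] * d2 f) j) i = of_nat j * coeff (coeff f j) i"
    by (cases j) (simp_all add: coeff_pCons coeff_d2)
  ultimately show ?thesis
    by (simp add: euler_def algebra_simps)
qed

lemma euler_mult: "euler (f * g) = euler f * g + f * euler g"
  by (simp add: euler_def d1_mult d2_mult algebra_simps)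

text \<open>\<open>euler\<close> multiplies the coefficient of \<open>x1^i x2^j\<close> by
  \<open>i + j\<close>, and in characteristic zero this scalar determines the degree. Degrees of
  products then follow from the product rule.\<close>

lemma homogeneous_iff_euler: "homogeneous_poly d f \<longleftrightarrow> euler f = of_nat d * f"
proof -
  have "euler f = of_nat d * f \<longleftrightarrow>
      (\<forall>i j. of_nat (i + j) * coeff (coeff f j) i = of_nat d * coeff (coeff f j) i)"
    by (simp add: poly_eq_iff coeff_euler of_nat_poly) metis
  then show ?thesis
    unfolding homogeneous_poly_def by (metis mult_cancel_right of_nat_eq_iff)
qed

lemma homogeneous_mult:
  fixes f g :: "'a::field_char_0 S"
  assumes "homogeneous_poly m f" "homogeneous_poly n g"
  shows "homogeneous_poly (m + n) (f * g)"
  using assms by (simp add: homogeneous_iff_euler euler_mult algebra_simps)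

lemma homogeneous_diff:
  fixes f g :: "'a::field_char_0 S"
  assumes "homogeneous_poly n f" "homogeneous_poly n g"
  shows "homogeneous_poly n (f - g)"
  using assms unfolding homogeneous_poly_def by (metis coeff_diff diff_zero)

lemma homogeneous_1: "homogeneous_poly 0 (1 :: 'a::field_char_0 S)"
  by (simp add: homogeneous_poly_def coeff_1 if_distrib)

lemma homogeneous_power:
  fixes f :: "'a::field_char_0 S"
  shows "homogeneous_poly n f \<Longrightarrow> homogeneous_poly (k * n) (f ^ k)"
  by (induction k) (auto simp: homogeneous_1 intro: homogeneous_mult)

lemma homogeneous_prod:
  fixes f :: "'i \<Rightarrow> 'a::field_char_0 S"
  assumes "finite I" "\<And>i. i \<in> I \<Longrightarrow> homogeneous_poly (d i) (f i)"
  shows "homogeneous_poly (\<Sum>i\<in>I. d i) (\<Prod>i\<in>I. f i)"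
  using assms by (induction I rule: finite_induct) (auto simp: homogeneous_1 homogeneous_mult)

text \<open>For \<open>d = 0\<close> the truncated \<open>d - 1\<close> does no harm: the derivative
  is then zero.\<close>

lemma homogeneous_d1:
  fixes f :: "'a::field_char_0 S"
  shows "homogeneous_poly d f \<Longrightarrow> homogeneous_poly (d - 1) (d1 f)"
  unfolding homogeneous_poly_def coeff_d1 by (metis add_Suc diff_Suc_1 mult_not_zero)

lemma homogeneous_d2:
  fixes f :: "'a::field_char_0 S"
  shows "homogeneous_poly d f \<Longrightarrow> homogeneous_poly (d - 1) (d2 f)"
  unfolding homogeneous_poly_def coeff_d2 by (metis add_Suc_right diff_Suc_1 mult_not_zero)

lemma homogeneous_0_const:
  fixes f :: "'a::field_char_0 S"
  shows "homogeneous_poly 0 f \<Longrightarrow> f = [:[:coeff (coeff f 0) 0:]:]"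
  unfolding homogeneous_poly_def
  by (auto simp: poly_eq_iff coeff_pCons split: nat.splits)

text \<open>Applying \<open>euler\<close> to the product and cancelling \<open>f\<close> shows that
  every monomial of \<open>g\<close> has degree \<open>n - k\<close>. The equation
  \<open>n = k + l\<close> serves below as a degree bound.\<close>

lemma homogeneous_quotient:
  fixes f g :: "'a::field_char_0 S"
  assumes "homogeneous_poly n (f * g)" "homogeneous_poly k f" "f * g \<noteq> 0"
  obtains l where "n = k + l" "homogeneous_poly l g"
proof -
  have "f * euler g = f * (of_nat n * g - of_nat k * g)"
    using assms(1,2) by (simp add: homogeneous_iff_euler euler_mult algebra_simps)
  \<comment> \<open>The sum form avoids a subtraction, so that degrees compare as natural
    numbers.\<close>
  then have eu: "euler g + of_nat k * g = of_nat n * g"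
    using assms(3) by simp
  have coeffs: "i + j + k = n" if "coeff (coeff g j) i \<noteq> 0" for i j
  proof -
    have "coeff (coeff (euler g + of_nat k * g) j) i = coeff (coeff (of_nat n * g) j) i"
      by (simp only: eu)
    then have "of_nat (i + j + k) * coeff (coeff g j) i = of_nat n * coeff (coeff g j) i"
      by (simp add: coeff_euler of_nat_poly algebra_simps)
    then show ?thesis using that by (metis mult_cancel_right of_nat_eq_iff)
  qed
  obtain i j where "coeff (coeff g j) i \<noteq> 0"
    using assms(3) by (metis leading_coeff_0_iff mult_zero_right)
  then have "k \<le> n" using coeffs by force
  with coeffs have "homogeneous_poly (n - k) g" unfolding homogeneous_poly_def by force
  with \<open>k \<le> n\<close> show thesis using that by (metis le_add_diff_inverse)
qed

text \<open>If \<open>f\<close> were nonzero, the coefficients of the two sides at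
  \<open>degree f + degree g - 1\<close> would be \<open>degree g\<close> and
  \<open>degree f\<close> times the same nonzero product of leading coefficients.\<close>

lemma wronskian_zero:
  fixes f g :: "'b::{idom,ring_char_0} poly"
  assumes "f * pderiv g = g * pderiv f" "degree f < degree g"
  shows "f = 0"
proof (rule ccontr)
  assume "f \<noteq> 0"
  obtain i where i: "degree g = Suc i" using assms(2)
    by (metis Suc_pred' zero_less_iff_neq_zero not_less_zero)
  have g: "coeff (f * pderiv g) (degree f + i) = lead_coeff f * (of_nat (Suc i) * lead_coeff g)"
    using coeff_mult_degree_sum[of f "pderiv g"] i by (simp add: degree_pderiv coeff_pderiv)
  have f: "coeff (g * pderiv f) (degree f + i) = of_nat (degree f) * lead_coeff f * lead_coeff g"
  proof (cases "degree f")
    case 0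
    then have "pderiv f = 0" by (simp add: pderiv_eq_0_iff)
    then show ?thesis using 0 by simp
  next
    case (Suc j)
    then show ?thesis
      using coeff_mult_degree_sum[of g "pderiv f"] i
      by (simp add: degree_pderiv coeff_pderiv add.commute mult.commute)
  qed
  have "of_nat (Suc i) * (lead_coeff f * lead_coeff g) = of_nat (degree f) * (lead_coeff f * lead_coeff g)"
    using f g assms(1) by (simp add: algebra_simps)
  then have "Suc i = degree f"
    using \<open>f \<noteq> 0\<close> assms(2)
    by (metis mult_cancel_right mult_eq_0_iff leading_coeff_0_iff of_nat_eq_iff degree_0 not_less_zero)
  then show False using assms(2) i by simp
qed

text \<open>Subtracting a scalar multiple of \<open>g\<close> cancels the top coefficient in
  \<open>x2\<close>; the Wronskian relation passes to the difference, which
  \<open>wronskian_zero\<close> then kills.\<close>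

lemma homogeneous_proportional:
  fixes f g :: "'a::field_char_0 S"
  assumes f: "homogeneous_poly d f" and g: "homogeneous_poly d g"
    and le: "degree f \<le> degree g" and "f * pderiv g = g * pderiv f" and "g \<noteq> 0"
  obtains c where "f = [:[:c:]:] * g"
proof -
  define i where "i = degree g"
  \<comment> \<open>By homogeneity each coefficient in \<open>K[x1]\<close> is a monomial, so the
    one of \<open>f\<close> at \<open>i\<close> is a scalar multiple of that of
    \<open>g\<close>.\<close>
  have mon: "coeff p i = monom (coeff (coeff p i) (d - i)) (d - i)" if "homogeneous_poly d p" for p :: "'a S"
    using that unfolding homogeneous_poly_def poly_eq_iff
    by (auto simp: coeff_monom) (metis add_diff_cancel_right')
  define c where "c = coeff (coeff f i) (d - i) / coeff (coeff g i) (d - i)"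
  have "coeff (coeff g i) (d - i) \<noteq> 0"
    using mon[OF g] \<open>g \<noteq> 0\<close> by (metis i_def leading_coeff_0_iff monom_eq_0)
  then have ci: "coeff f i = smult c (coeff g i)"
    by (subst mon[OF f], subst mon[OF g]) (simp add: smult_monom c_def)
  define F where "F = f - [:[:c:]:] * g"
  have "F * pderiv g = g * pderiv F"
    using assms(4) by (simp add: F_def pderiv_diff pderiv_smult algebra_simps)
  moreover have "coeff F i = 0" by (simp add: F_def ci)
  moreover have "degree F \<le> degree g"
    unfolding F_def using le by (intro degree_diff_le) (auto intro: order_trans[OF degree_smult_le])
  ultimately have "F = 0"
    using wronskian_zero[of F g] by (metis i_def leading_coeff_0_iff le_neq_implies_less)
  then show thesis using that by (simp add: F_def)
qed


subsection \<open>Divisibility by products of prime powers\<close>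

text \<open>For \<open>b = 0\<close> the form is a prime of \<open>K[x1]\<close>; otherwise it is
  associated to \<open>x2 - r\<close> with \<open>r\<close> in \<open>K[x1]\<close>, which divides a
  polynomial exactly if that vanishes at \<open>x2 = r\<close>.\<close>

lemma prime_elem_linear_form:
  fixes a b :: "'a::field_char_0"
  assumes "a \<noteq> 0 \<or> b \<noteq> 0"
  shows "prime_elem [:[:0, a:], [:b:]:]"
proof (cases "b = 0")
  case True
  then show ?thesis
    using assms by (simp add: lift_prime_elem_poly prime_elem_linear_field_poly)
next
  case False
  define r where "r = [:0, - a / b:]"
  have lin: "[:[:0, a:], [:b:]:] = [:[:b:]:] * [:- r, 1:]"
    using False by (simp add: r_def)
  have "is_unit [:[:b:]:]"
    using False by (simp add: is_unit_const_poly_iff dvd_field_iff)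
  moreover have "prime_elem [:- r, 1:]"
    by (rule prime_elemI) (auto simp: poly_eq_0_iff_dvd [symmetric] is_unit_poly_iff)
  ultimately show ?thesis
    unfolding lin by (rule prime_elem_mult_unit_left[THEN iffD2])
qed

lemma linear_form_not_dvd:
  fixes a b c d :: "'a::field_char_0"
  assumes "a * d \<noteq> c * b"
  shows "\<not> [:[:0, a:], [:b:]:] dvd [:[:0, c:], [:d:]:]"
proof
  assume "[:[:0, a:], [:b:]:] dvd [:[:0, c:], [:d:]:]"
  then obtain s where "[:[:0, c:], [:d:]:] = [:[:0, a:], [:b:]:] * s" by (elim dvdE)
  \<comment> \<open>The point \<open>x1 = - b\<close>, \<open>x2 = a\<close> is a zero of the first
    form but not of the second.\<close>
  then have "poly (poly [:[:0, c:], [:d:]:] [:a:]) (- b) = poly (poly ([:[:0, a:], [:b:]:] * s) [:a:]) (- b)"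
    by (rule arg_cong)
  then show False using assms by (simp add: algebra_simps)
qed

lemma prime_elem_dvd_prod_powerD:
  fixes q :: "'b::comm_semiring_1"
  assumes "finite I" "prime_elem q" "q dvd (\<Prod>i\<in>I. p i ^ m i)"
  obtains i where "i \<in> I" "q dvd p i"
  using assms
proof (induction I arbitrary: thesis rule: finite_induct)
  case empty
  then show ?case using prime_elem_not_unit by auto
next
  case (insert x F)
  then show ?case
    using prime_elem_dvd_mult_iff[of q] prime_elem_dvd_power[of q] by (metis insertCI prod.insert)
qed

text \<open>\<open>p k\<close> does not divide the product over the other indices, so its power
  passes entirely to the cofactor.\<close>

lemma prod_prime_powers_dvd:
  fixes p :: "'i \<Rightarrow> 'b::idom"
  assumes "finite I" "\<And>i. i \<in> I \<Longrightarrow> prime_elem (p i)"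
    and "\<And>i j. i \<in> I \<Longrightarrow> j \<in> I \<Longrightarrow> i \<noteq> j \<Longrightarrow> \<not> p i dvd p j"
    and "\<And>i. i \<in> I \<Longrightarrow> p i ^ m i dvd x"
  shows "(\<Prod>i\<in>I. p i ^ m i) dvd x"
  using assms
proof (induction I rule: finite_induct)
  case empty
  then show ?case by simp
next
  case (insert k F)
  then obtain s where s: "x = (\<Prod>i\<in>F. p i ^ m i) * s" by (metis dvdE insertCI)
  have nd: "\<not> p k dvd (\<Prod>i\<in>F. p i ^ m i)"
    using insert prime_elem_dvd_prod_powerD[of F "p k" p m] by (metis insertCI)
  have "p k ^ n dvd P * s \<Longrightarrow> \<not> p k dvd P \<Longrightarrow> p k ^ n dvd s" for n P
    using insert.prems(1)[of k]
  proof (induction n arbitrary: s)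
    case (Suc n)
    then have "p k dvd P * s" by (metis dvd_mult_left power_Suc)
    then obtain t where t: "s = p k * t" using Suc.prems by (auto simp: prime_elem_dvd_mult_iff)
    then have "p k * p k ^ n dvd p k * (P * t)" using Suc.prems(1) by (simp add: algebra_simps)
    then have "p k ^ n dvd P * t" using Suc.prems(3) by auto
    then have "p k ^ n dvd t" using Suc by blast
    then show ?case by (simp add: t mult_dvd_mono)
  qed simp
  then have "p k ^ m k dvd s" using insert.prems(3)[of k] nd s by simp
  then show ?case
    using insert.hyps by (simp add: s mult.commute mult_dvd_mono)
qed

text \<open>A prime that does not divide \<open>x\<close> can be cancelled from a multiple of
  \<open>x\<close>; removing all factors leaves \<open>x dvd 1\<close>.\<close>

lemma is_unit_if_dvd_prod_power:
  fixes p :: "'i \<Rightarrow> 'b::algebraic_semidom"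
  assumes "finite I" "\<And>i. i \<in> I \<Longrightarrow> prime_elem (p i)"
    and "x dvd (\<Prod>i\<in>I. p i ^ m i)" "\<And>i. i \<in> I \<Longrightarrow> \<not> p i dvd x"
  shows "is_unit x"
  using assms
proof (induction I rule: finite_induct)
  case empty
  then show ?case by simp
next
  case (insert k F)
  have cancel: "x dvd p k ^ n * P \<Longrightarrow> \<not> p k dvd x \<Longrightarrow> x dvd P" for n P
    using insert.prems(1)[of k]
  proof (induction n)
    case (Suc n)
    then obtain s where s: "p k * (p k ^ n * P) = x * s" by (auto simp: mult.assoc elim: dvdE)
    then have "p k dvd s" using Suc.prems by (metis dvd_triv_left insertI1 prime_elem_dvd_mult_iff)
    then obtain t where "s = p k * t" by (elim dvdE)
    then have "p k * (p k ^ n * P) = p k * (x * t)" using s by (simp add: mult_ac)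
    moreover have "p k \<noteq> 0" using Suc.prems(3) by (simp add: prime_elem_not_zeroI)
    ultimately have "p k ^ n * P = x * t" by (simp only: mult_cancel_left simp_thms)
    then have "x dvd p k ^ n * P" by simp
    then show ?case using Suc by blast
  qed simp
  have "x dvd p k ^ m k * (\<Prod>i\<in>F. p i ^ m i)"
    using insert.prems(2) insert.hyps by simp
  then have "x dvd (\<Prod>i\<in>F. p i ^ m i)"
    by (rule cancel) (use insert.prems(3) in blast)
  then show ?case using insert.IH insert.prems(1,3) by blast
qed

lemma is_unit_homogeneous:
  fixes f :: "'a::field_char_0 S"
  assumes "is_unit f" "homogeneous_poly n f"
  shows "n = 0"
proof -
  obtain g where g: "1 = f * g" using assms(1) by (elim dvdE)
  then have "homogeneous_poly 0 (f * g)" using homogeneous_1 by metis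
  then show ?thesis
    using homogeneous_quotient[of 0 f g n] assms(2) g by (metis add_is_0 zero_neq_one)
qed

subsection \<open>Bases and determinants\<close>

definition det2 :: "'a::field_char_0 Der \<Rightarrow> 'a Der \<Rightarrow> 'a S" where
  "det2 \<theta> \<phi> = \<theta> $ 1 * \<phi> $ 2 - \<theta> $ 2 * \<phi> $ 1"

lemma vec2_eq_iff: "(x :: 'b ^ 2) = y \<longleftrightarrow> x $ 1 = y $ 1 \<and> x $ 2 = y $ 2"
  by (simp add: vec_eq_iff forall_2)

lemma span_pair: "der.span {\<theta>, \<phi>} = {p *s \<theta> + q *s \<phi> | p q. True}"
proof -
  have "x \<in> der.span {\<theta>, \<phi>} \<longleftrightarrow> (\<exists>p q. x = p *s \<theta> + q *s \<phi>)" for x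
    by (auto simp: der.span_insert der.span_singleton diff_eq_eq add.commute)
  then show ?thesis by auto
qed

lemma is_basis_commute: "is_basis M \<theta> \<phi> \<longleftrightarrow> is_basis M \<phi> \<theta>"
  by (simp add: is_basis_def insert_commute eq_commute)

text \<open>A zero determinant yields the relations
  \<open>\<phi> $ i *s \<theta> - \<theta> $ i *s \<phi> = 0\<close>; independence makes all
  coordinates zero, and then \<open>\<theta> = \<phi>\<close>.\<close>

lemma is_basis_det2_nonzero:
  assumes "is_basis M \<theta> \<phi>"
  shows "det2 \<theta> \<phi> \<noteq> 0"
proof
  assume 0: "det2 \<theta> \<phi> = 0"
  have ne: "\<theta> \<noteq> \<phi>" and indep: "\<not> der.dependent {\<theta>, \<phi>}"
    using assms by (auto simp: is_basis_def)
  have *: "p = 0 \<and> q = 0" if "p *s \<theta> + q *s \<phi> = 0" for p q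
  proof -
    define u where "u = (\<lambda>x. if x = \<theta> then p else q)"
    have "(\<Sum>x\<in>{\<theta>, \<phi>}. u x *s x) = 0"
      using ne that by (simp add: u_def)
    then have "u \<theta> = 0" "u \<phi> = 0"
      using indep by (auto simp: der.dependent_finite)
    then show ?thesis using ne by (auto simp: u_def split: if_splits)
  qed
  have "\<phi> $ 1 *s \<theta> + (- \<theta> $ 1) *s \<phi> = 0" "\<phi> $ 2 *s \<theta> + (- \<theta> $ 2) *s \<phi> = 0"
    using 0 by (simp_all add: vec2_eq_iff det2_def algebra_simps)
  then have "\<theta> = 0" "\<phi> = 0"
    using *[of "\<phi> $ 1" "- \<theta> $ 1"] *[of "\<phi> $ 2" "- \<theta> $ 2"] by (simp_all add: vec2_eq_iff)
  then show False using ne by simp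
qed

text \<open>The quotient is the determinant of the matrix expressing \<open>x\<close> and
  \<open>y\<close> in the basis.\<close>

lemma det2_dvd_det2:
  assumes "is_basis M \<theta> \<phi>" "x \<in> M" "y \<in> M"
  shows "det2 \<theta> \<phi> dvd det2 x y"
proof -
  obtain p q r s where "x = p *s \<theta> + q *s \<phi>" "y = r *s \<theta> + s *s \<phi>"
    using assms by (force simp: is_basis_def span_pair)
  then have "det2 x y = det2 \<theta> \<phi> * (p * s - q * r)"
    by (simp add: det2_def algebra_simps)
  then show ?thesis by simp
qed

lemma homogeneous_det2:
  assumes "homogeneous_der a \<theta>" "homogeneous_der b \<phi>"
  shows "homogeneous_poly (a + b) (det2 \<theta> \<phi>)"
  using assms by (auto simp: det2_def homogeneous_der_def intro!: homogeneous_diff homogeneous_mult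
      simp: add.commute)

text \<open>By Cramer's rule, \<open>det2 \<theta> \<phi>\<close> times a coefficient of
  \<open>\<eta>\<close> is a determinant of known degree, so a nonzero coefficient bounds
  \<open>c\<close> from below.\<close>

lemma is_basis_min_degree:
  assumes "is_basis M \<theta> \<phi>" "homogeneous_der a \<theta>" "homogeneous_der b \<phi>" "a \<le> b"
    and "\<eta> \<in> M" "homogeneous_der c \<eta>"
  shows "a \<le> c"
proof -
  obtain p q where \<eta>: "\<eta> = p *s \<theta> + q *s \<phi>"
    using assms by (force simp: is_basis_def span_pair)
  have d: "det2 \<eta> \<phi> = det2 \<theta> \<phi> * p" "det2 \<theta> \<eta> = det2 \<theta> \<phi> * q"
    by (simp_all add: \<eta> det2_def algebra_simps)
  have nz: "det2 \<theta> \<phi> \<noteq> 0" using assms(1) by (rule is_basis_det2_nonzero)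
  have hom: "homogeneous_poly (a + b) (det2 \<theta> \<phi>)"
    "homogeneous_poly (c + b) (det2 \<theta> \<phi> * p)" "homogeneous_poly (a + c) (det2 \<theta> \<phi> * q)"
    using homogeneous_det2[OF assms(2,3)] homogeneous_det2[OF assms(6,3)]
      homogeneous_det2[OF assms(2,6)] d by simp_all
  have "p \<noteq> 0 \<or> q \<noteq> 0" using assms(6) \<eta> by (auto simp: homogeneous_der_def)
  then show ?thesis
  proof
    assume "p \<noteq> 0"
    then obtain l where "c + b = (a + b) + l"
      using homogeneous_quotient[OF hom(2,1)] nz by auto
    then show ?thesis by simp
  next
    assume "q \<noteq> 0"
    then obtain l where "a + c = (a + b) + l"
      using homogeneous_quotient[OF hom(3,1)] nz by auto
    then show ?thesis using assms(4) by simp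
  qed
qed

subsection \<open>Exponents of a multiarrangement\<close>

text \<open>The arrangement enters only through finitely many nonzero, pairwise non-proportional
  forms.\<close>

locale linear_forms =
  fixes A :: "('a::field_char_0 ^ 2) set set" and \<alpha> :: "('a ^ 2) set \<Rightarrow> 'a ^ 2 \<Rightarrow> 'a"
  assumes finite_A: "finite A"
    and nonzero: "H \<in> A \<Longrightarrow> \<alpha> H (axis 1 1) \<noteq> 0 \<or> \<alpha> H (axis 2 1) \<noteq> 0"
    and independent: "H \<in> A \<Longrightarrow> K \<in> A \<Longrightarrow> H \<noteq> K \<Longrightarrow>
      \<alpha> H (axis 1 1) * \<alpha> K (axis 2 1) \<noteq> \<alpha> K (axis 1 1) * \<alpha> H (axis 2 1)"
begin

abbreviation "L H \<equiv> form_poly (\<alpha> H)"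

abbreviation "Q m \<equiv> (\<Prod>H\<in>A. L H ^ m H)"

lemma prime_elem_L: "H \<in> A \<Longrightarrow> prime_elem (L H)"
  unfolding form_poly_def by (intro prime_elem_linear_form nonzero)

lemma L_not_dvd: "H \<in> A \<Longrightarrow> K \<in> A \<Longrightarrow> H \<noteq> K \<Longrightarrow> \<not> L H dvd L K"
  unfolding form_poly_def by (intro linear_form_not_dvd independent)

lemma homogeneous_L: "homogeneous_poly 1 (L H)"
  by (auto simp: homogeneous_poly_def form_poly_def coeff_pCons split: nat.splits)

lemma homogeneous_prod_L:
  assumes "B \<subseteq> A"
  shows "homogeneous_poly (sum m B) (\<Prod>H\<in>B. L H ^ m H)"
proof (rule homogeneous_prod)
  show "finite B" using assms finite_A by (rule finite_subset)
  show "homogeneous_poly (m H) (L H ^ m H)" for H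
    using homogeneous_power[OF homogeneous_L, of "m H" H] by simp
qed

lemma prod_L_nonzero: "B \<subseteq> A \<Longrightarrow> (\<Prod>H\<in>B. L H ^ m H) \<noteq> 0"
  using prime_elem_not_zeroI[OF prime_elem_L] finite_subset[OF _ finite_A] by auto

lemma Q_remove: "H \<in> A \<Longrightarrow> Q m = L H ^ m H * (\<Prod>K\<in>A - {H}. L K ^ m K)"
  using finite_A by (rule prod.remove)

lemma L_not_dvd_prod:
  assumes H: "H \<in> A"
  shows "\<not> L H dvd (\<Prod>K\<in>A - {H}. L K ^ m K)"
proof
  assume dvd: "L H dvd (\<Prod>K\<in>A - {H}. L K ^ m K)"
  obtain K where "K \<in> A - {H}" "L H dvd L K"
    using prime_elem_dvd_prod_powerD[OF _ prime_elem_L[OF H] dvd] finite_A by blast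
  then show False using L_not_dvd[OF H, of K] by auto
qed

lemma prod_L_dvd:
  assumes "B \<subseteq> A" "\<And>H. H \<in> B \<Longrightarrow> L H ^ m H dvd f"
  shows "(\<Prod>H\<in>B. L H ^ m H) dvd f"
proof (rule prod_prime_powers_dvd)
  show "finite B" using assms(1) finite_A by (rule finite_subset)
qed (use assms prime_elem_L L_not_dvd in blast)+

lemma der_app_L:
  "der_app \<theta> (L H) = [:[:\<alpha> H (axis 1 1):]:] * \<theta> $ 1 + [:[:\<alpha> H (axis 2 1):]:] * \<theta> $ 2"
proof -
  have "d1 (L H) = [:[:\<alpha> H (axis 1 1):]:]"
    by (simp add: poly_eq_iff coeff_d1 form_poly_def coeff_pCons split: nat.splits)
  moreover have "d2 (L H) = [:[:\<alpha> H (axis 2 1):]:]"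
    by (simp add: d2_def form_poly_def pderiv_pCons)
  ultimately show ?thesis by (simp add: der_app_def mult.commute)
qed

lemma dvd_const_mult_iff: "c \<noteq> 0 \<Longrightarrow> f dvd [:[:c:]:] * g \<longleftrightarrow> f dvd (g :: 'a S)"
  by (intro dvd_mult_unit_iff') (simp add: is_unit_const_poly_iff dvd_field_iff)

text \<open>A coefficient of the form times \<open>det2\<close> is a combination of the values of
  \<open>\<theta>\<close> and \<open>\<phi>\<close> on the form, and one of the two coefficients is
  nonzero.\<close>

lemma L_power_dvd_det2:
  assumes "H \<in> A" "L H ^ n dvd der_app \<theta> (L H)" "L H ^ n dvd der_app \<phi> (L H)"
  shows "L H ^ n dvd det2 \<theta> \<phi>"
proof -
  have "[:[:\<alpha> H (axis 1 1):]:] * det2 \<theta> \<phi> = der_app \<theta> (L H) * \<phi> $ 2 - der_app \<phi> (L H) * \<theta> $ 2"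
    "[:[:\<alpha> H (axis 2 1):]:] * det2 \<theta> \<phi> = der_app \<phi> (L H) * \<theta> $ 1 - der_app \<theta> (L H) * \<phi> $ 1"
    by (simp_all add: der_app_L det2_def algebra_simps)
  then have "L H ^ n dvd [:[:\<alpha> H (axis 1 1):]:] * det2 \<theta> \<phi>"
    "L H ^ n dvd [:[:\<alpha> H (axis 2 1):]:] * det2 \<theta> \<phi>"
    using assms by (simp_all only: dvd_diff dvd_mult2)
  then show ?thesis
    using nonzero[OF \<open>H \<in> A\<close>] dvd_const_mult_iff by metis
qed

lemma Q_dvd_det2: "\<theta> \<in> D A \<alpha> m \<Longrightarrow> \<phi> \<in> D A \<alpha> m \<Longrightarrow> Q m dvd det2 \<theta> \<phi>"
  by (rule prod_L_dvd) (simp_all add: D_def L_power_dvd_det2)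

lemma subspace_D: "der.subspace (D A \<alpha> m)"
  unfolding der.subspace_def D_def
proof (safe, goal_cases)
  case 1
  show ?case by (simp add: der_app_def)
next
  case (2 \<theta> \<phi> H)
  have "der_app (\<theta> + \<phi>) (L H) = der_app \<theta> (L H) + der_app \<phi> (L H)"
    by (simp add: der_app_def algebra_simps)
  then show ?case using 2 by simp
next
  case (3 c \<theta> H)
  have "der_app (c *s \<theta>) (L H) = c * der_app \<theta> (L H)"
    by (simp add: der_app_def algebra_simps)
  then show ?case using 3 by simp
qed

text \<open>The constant derivation along \<open>H\<close> kills \<open>L H\<close>; the product
  takes care of the other lines.\<close>

lemma line_derivation_in_D:
  assumes "H \<in> A"
  shows "vector [[:[:- \<alpha> H (axis 2 1):]:] * (\<Prod>K\<in>A - {H}. L K ^ m K),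
    [:[:\<alpha> H (axis 1 1):]:] * (\<Prod>K\<in>A - {H}. L K ^ m K)] \<in> D A \<alpha> m"
    (is "vector [_ * ?q, _] \<in> _")
proof -
  have "L K ^ m K dvd [:[:\<alpha> K (axis 1 1):]:] * ([:[:- \<alpha> H (axis 2 1):]:] * ?q) +
      [:[:\<alpha> K (axis 2 1):]:] * ([:[:\<alpha> H (axis 1 1):]:] * ?q)" if "K \<in> A" for K
  proof (cases "K = H")
    case True
    have "[:[:a:]:] * ([:[:- b:]:] * q) + [:[:b:]:] * ([:[:a:]:] * q) = 0" for a b and q :: "'a S"
      by (simp add: mult.commute flip: smult_add_left)
    then show ?thesis using True by simp
  next
    case False
    then have "L K ^ m K dvd ?q"
      using \<open>K \<in> A\<close> finite_A by (intro dvd_prodI[of "A - {H}" K "\<lambda>K. L K ^ m K"]) auto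
    then show ?thesis by (intro dvd_add dvd_mult)
  qed
  then show ?thesis by (simp only: D_def der_app_L vector_2 mem_Collect_eq) blast
qed

lemma coordinate_derivations_in_D: "vector [Q m, 0] \<in> D A \<alpha> m" "vector [0, Q m] \<in> D A \<alpha> m"
proof -
  have "L K ^ m K dvd Q m" if "K \<in> A" for K
    using dvd_prodI[OF finite_A that, of "\<lambda>K. L K ^ m K"] .
  then show "vector [Q m, 0] \<in> D A \<alpha> m" "vector [0, Q m] \<in> D A \<alpha> m"
    unfolding D_def der_app_L vector_2 mult_zero_right add_0_left add_0_right mem_Collect_eq
    by (blast intro: dvd_mult)+
qed

text \<open>The determinant of a basis divides \<open>Q m\<close> times the product over all lines but \<open>H\<close>, as one
  sees from the derivation along \<open>H\<close>, multiplied by that product. Letting \<open>H\<close> vary leaves only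
  a unit besides \<open>Q m\<close>.\<close>

lemma sum_exponents:
  assumes basis: "is_basis (D A \<alpha> m) \<theta> \<phi>" and "homogeneous_der a \<theta>" "homogeneous_der b \<phi>"
    and "A \<noteq> {}"
  shows "a + b = sum m A"
proof -
  have mem: "\<theta> \<in> D A \<alpha> m" "\<phi> \<in> D A \<alpha> m"
    using basis by (auto simp: is_basis_def intro: der.span_base)
  then obtain R where R: "det2 \<theta> \<phi> = Q m * R" using Q_dvd_det2[OF mem] by (elim dvdE)
  have R_dvd: "R dvd (\<Prod>K\<in>A - {H}. L K ^ m K)" (is "R dvd ?q") if H: "H \<in> A" for H
  proof -
    have det: "det2 (vector [f, 0]) (vector [g, h]) = f * h"
      "det2 (vector [0, f]) (vector [g, h]) = - (f * g)" for f g h :: "'a S"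
      by (simp_all add: det2_def)
    have "Q m \<noteq> 0" by (rule prod_L_nonzero) simp
    \<comment> \<open>One coefficient of \<open>\<alpha> H\<close> may vanish, so the derivation
      along \<open>H\<close> is paired with both coordinate derivations.\<close>
    have "Q m * R dvd Q m * ([:[:\<alpha> H (axis 1 1):]:] * ?q)"
      "Q m * R dvd Q m * ([:[:- \<alpha> H (axis 2 1):]:] * ?q)"
      using det2_dvd_det2[OF basis coordinate_derivations_in_D(1) line_derivation_in_D[OF H]]
        det2_dvd_det2[OF basis coordinate_derivations_in_D(2) line_derivation_in_D[OF H]]
      unfolding R det by (simp_all only: dvd_minus_iff)
    then have "R dvd [:[:\<alpha> H (axis 1 1):]:] * ?q" "R dvd [:[:- \<alpha> H (axis 2 1):]:] * ?q"
      using \<open>Q m \<noteq> 0\<close> unfolding dvd_mult_cancel_left by blast+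
    moreover have "\<alpha> H (axis 1 1) \<noteq> 0 \<or> - \<alpha> H (axis 2 1) \<noteq> 0" using nonzero[OF H] by simp
    ultimately show ?thesis
      using dvd_const_mult_iff[of "\<alpha> H (axis 1 1)" R ?q]
        dvd_const_mult_iff[of "- \<alpha> H (axis 2 1)" R ?q] by blast
  qed
  obtain H where "H \<in> A" using \<open>A \<noteq> {}\<close> by auto
  have "is_unit R"
  proof (rule is_unit_if_dvd_prod_power[OF _ _ R_dvd[OF \<open>H \<in> A\<close>]])
    show "finite (A - {H})" using finite_A by simp
    fix K assume "K \<in> A - {H}"
    then have K: "K \<in> A" by simp
    then show "prime_elem (L K)" by (rule prime_elem_L)
    show "\<not> L K dvd R" using L_not_dvd_prod[OF K] dvd_trans[OF _ R_dvd[OF K]] by blast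
  qed
  have ab: "homogeneous_poly (a + b) (Q m * R)"
    using homogeneous_det2 assms(2,3) unfolding R[symmetric] .
  have "Q m * R \<noteq> 0" using is_basis_det2_nonzero[OF basis] R by simp
  then obtain l where "a + b = sum m A + l" "homogeneous_poly l R"
    using homogeneous_quotient[OF ab homogeneous_prod_L] by blast
  then show ?thesis using is_unit_homogeneous[OF \<open>is_unit R\<close>] by simp
qed

text \<open>The smaller exponent is the least degree of a homogeneous element, and
  \<open>sum_exponents\<close> determines the other.\<close>

lemma exponents_unique:
  assumes "exponents A \<alpha> m a b" "exponents A \<alpha> m a' b'" "a \<le> b" "a' \<le> b'" "A \<noteq> {}"
  shows "a = a' \<and> b = b'"
proof -
  obtain \<theta> \<phi> \<theta>' \<phi>' where
    *: "is_basis (D A \<alpha> m) \<theta> \<phi>" "homogeneous_der a \<theta>" "homogeneous_der b \<phi>" and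
    **: "is_basis (D A \<alpha> m) \<theta>' \<phi>'" "homogeneous_der a' \<theta>'" "homogeneous_der b' \<phi>'"
    using assms by (auto simp: exponents_def)
  have "\<theta> \<in> D A \<alpha> m" "\<theta>' \<in> D A \<alpha> m"
    using * ** by (auto simp: is_basis_def intro: der.span_base)
  then have "a = a'"
    using is_basis_min_degree[OF * assms(3)] is_basis_min_degree[OF ** assms(4)] *(2) **(2)
    by (metis le_antisym)
  then show ?thesis
    using sum_exponents[OF * assms(5)] sum_exponents[OF ** assms(5)] by simp
qed

lemma Delta_eq:
  assumes "exponents A \<alpha> m a b" "a \<le> b" "A \<noteq> {}"
  shows "Delta A \<alpha> m = int b - int a"
  unfolding Delta_def
proof (rule the_equality)
  show "\<exists>a' b'. exponents A \<alpha> m a' b' \<and> int b - int a = \<bar>int a' - int b'\<bar>"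
    using assms by (intro exI[of _ a] exI[of _ b]) auto
next
  fix k assume "\<exists>a' b'. exponents A \<alpha> m a' b' \<and> k = \<bar>int a' - int b'\<bar>"
  then obtain a' b' where k: "exponents A \<alpha> m a' b'" "k = \<bar>int a' - int b'\<bar>" by auto
  \<comment> \<open>The exponents come unordered; the swapped pair covers
    \<open>b' < a'\<close>.\<close>
  then have "exponents A \<alpha> m b' a'"
    unfolding exponents_def using is_basis_commute by blast
  then show "k = int b - int a"
    using k assms exponents_unique[OF assms(1) k(1)] exponents_unique[OF assms(1), of b' a']
    by (cases "a' \<le> b'") auto
qed

end

subsection \<open>The Jacobian determinant and the affine connection\<close>

text \<open>By Euler's formula, \<open>d\<close> times the Wronskian in \<open>x2\<close> equals
  \<open>x1\<close> times the Jacobian determinant.\<close>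

lemma jacobian_zero_imp_wronskian_zero:
  fixes f g :: "'a::field_char_0 S"
  assumes "homogeneous_poly d f" "homogeneous_poly d g" "d > 0"
    and J: "d1 f * d2 g = d2 f * d1 g"
  shows "f * pderiv g = g * pderiv f"
proof -
  have eu: "of_nat d * f = [:[:0, 1:]:] * d1 f + [:0, 1:] * d2 f"
    "of_nat d * g = [:[:0, 1:]:] * d1 g + [:0, 1:] * d2 g"
    using assms(1,2) unfolding homogeneous_iff_euler euler_def by simp_all
  have "of_nat d * f * d2 g - of_nat d * g * d2 f = [:[:0, 1:]:] * (d1 f * d2 g - d2 f * d1 g)"
    unfolding eu by (simp only: algebra_simps)
  also have "\<dots> = 0" by (simp add: J)
  finally have "of_nat d * (f * d2 g) = of_nat d * (g * d2 f)"
    by (simp add: mult.assoc)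
  then show ?thesis using \<open>d > 0\<close> unfolding d2_def mult_cancel_left by simp
qed

lemma det_jacobian_zero_imp_proportional:
  fixes \<theta> :: "'a::field_char_0 Der"
  assumes \<theta>: "homogeneous_der d \<theta>" and "d > 0"
    and J: "d1 (\<theta> $ 1) * d2 (\<theta> $ 2) = d2 (\<theta> $ 1) * d1 (\<theta> $ 2)"
  obtains p u v where "homogeneous_poly d p" "p \<noteq> 0" "u \<noteq> 0 \<or> v \<noteq> 0"
    "\<theta> $ 1 = [:[:u:]:] * p" "\<theta> $ 2 = [:[:v:]:] * p"
proof -
  have hom: "homogeneous_poly d (\<theta> $ 1)" "homogeneous_poly d (\<theta> $ 2)"
    and nz: "\<theta> $ 1 \<noteq> 0 \<or> \<theta> $ 2 \<noteq> 0"
    using \<theta> by (auto simp: homogeneous_der_def vec2_eq_iff)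
  have W: "\<theta> $ 1 * pderiv (\<theta> $ 2) = \<theta> $ 2 * pderiv (\<theta> $ 1)"
    using hom \<open>d > 0\<close> J by (rule jacobian_zero_imp_wronskian_zero)
  \<comment> \<open>The coordinate of larger degree in \<open>x2\<close> serves as
    \<open>p\<close>.\<close>
  consider "\<theta> $ 2 \<noteq> 0" "degree (\<theta> $ 1) \<le> degree (\<theta> $ 2)"
    | "\<theta> $ 1 \<noteq> 0" "degree (\<theta> $ 2) \<le> degree (\<theta> $ 1)"
    using nz by (metis degree_0 le0 nat_le_linear)
  then show thesis
  proof cases
    case 1
    obtain c where "\<theta> $ 1 = [:[:c:]:] * \<theta> $ 2"
      using homogeneous_proportional[OF hom 1(2) W 1(1)] by blast
    then show thesis using that[of "\<theta> $ 2" c 1] hom 1 by (simp flip: one_pCons)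
  next
    case 2
    obtain c where "\<theta> $ 2 = [:[:c:]:] * \<theta> $ 1"
      using homogeneous_proportional[OF hom(2,1) 2(2) W[symmetric] 2(1)] by blast
    then show thesis using that[of "\<theta> $ 1" 1 c] hom 2 by (simp flip: one_pCons)
  qed
qed

section \<open>Product rules and the connection\<close>

lemma der_app_mult: "der_app \<theta> (f * g) = der_app \<theta> f * g + f * der_app \<theta> g"
  by (simp add: der_app_def d1_mult d2_mult algebra_simps)

lemma der_app_power: "der_app \<theta> (f ^ Suc n) = of_nat (Suc n) * f ^ n * der_app \<theta> f"
  by (induction n) (simp_all add: der_app_mult algebra_simps)

lemma der_app_power_mult:
  assumes "n > 0"
  shows "der_app \<theta> (f ^ n * g) = of_nat n * f ^ (n - 1) * der_app \<theta> f * g + f ^ n * der_app \<theta> g"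
  using assms by (cases n) (simp_all only: der_app_mult der_app_power diff_Suc_1 not_less_zero)

lemma nabla_add: "nabla (\<theta> + \<phi>) \<eta> = nabla \<theta> \<eta> + nabla \<phi> \<eta>"
  by (simp add: nabla_def der_app_def vec_eq_iff algebra_simps)

lemma nabla_scale: "nabla (f *s \<theta>) \<eta> = f *s nabla \<theta> \<eta>"
  by (simp add: nabla_def der_app_def vec_eq_iff algebra_simps)

definition jac :: "'a::field_char_0 Der \<Rightarrow> 'a S" where
  "jac \<theta> = d1 (\<theta> $ 1) * d2 (\<theta> $ 2) - d2 (\<theta> $ 1) * d1 (\<theta> $ 2)"

text \<open>The Jacobian matrix of \<open>\<eta>\<close> sends the coefficients of
  \<open>\<theta>\<close> to those of \<open>nabla \<theta> \<eta>\<close>, and determinants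
  multiply.\<close>

lemma det2_nabla: "det2 (nabla \<theta> \<eta>) (nabla \<phi> \<eta>) = jac \<eta> * det2 \<theta> \<phi>"
  by (simp add: det2_def nabla_def der_app_def jac_def algebra_simps)

text \<open>This form lets the divisibility results on \<open>det2\<close> apply to the
  Jacobian.\<close>

lemma jac_eq_det2: "jac \<theta> = det2 (nabla (vector [1, 0]) \<theta>) (nabla (vector [0, 1]) \<theta>)"
  by (simp add: det2_nabla) (simp add: det2_def)

text \<open>By \<open>det2_nabla\<close>, both derivations have the same determinant with any third;
  the coordinate derivations read off the entries.\<close>

lemma nabla_inj:
  assumes "jac \<eta> \<noteq> 0" "nabla \<theta> \<eta> = nabla \<phi> \<eta>"
  shows "\<theta> = \<phi>"
proof -
  have "jac \<eta> * det2 \<theta> \<psi> = jac \<eta> * det2 \<phi> \<psi>" for \<psi>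
    using assms(2) by (simp flip: det2_nabla)
  then have "det2 \<theta> \<psi> = det2 \<phi> \<psi>" for \<psi> using assms(1) by simp
  from this[of "vector [0, 1]"] this[of "vector [1, 0]"] show ?thesis
    by (simp add: det2_def vec2_eq_iff)
qed

lemma cramer:
  assumes "det2 \<eta> Y = det2 X Y * p" "det2 X \<eta> = det2 X Y * q" "det2 X Y \<noteq> 0"
  shows "\<eta> = p *s X + q *s Y"
proof -
  have "det2 X Y * \<eta> $ 1 = det2 X Y * (p * X $ 1 + q * Y $ 1)"
    "det2 X Y * \<eta> $ 2 = det2 X Y * (p * X $ 2 + q * Y $ 2)"
    unfolding distrib_left mult.assoc[symmetric] assms(1,2)[symmetric]
    by (simp_all add: det2_def algebra_simps)
  then show ?thesis using assms(3) by (simp add: vec2_eq_iff)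
qed

section \<open>The connection on multiarrangement modules\<close>

context linear_forms
begin

text \<open>The coefficients of \<open>L H\<close> are constants, so \<open>\<theta>\<close> acts
  only on those of \<open>\<eta>\<close>.\<close>

lemma der_app_nabla_L: "der_app (nabla \<theta> \<eta>) (L H) = der_app \<theta> (der_app \<eta> (L H))"
proof -
  have const: "der_app \<theta> ([:[:c:]:] * f) = [:[:c:]:] * der_app \<theta> f" for c f
  proof -
    have "d1 [:[:c:]:] = 0" "d2 [:[:c:]:] = 0"
      by (simp_all add: d1_def d2_def map_poly_pCons pderiv_pCons)
    then show ?thesis unfolding der_app_mult by (simp add: der_app_def)
  qed
  have "der_app \<theta> (f + g) = der_app \<theta> f + der_app \<theta> g" for f g
    by (simp add: der_app_def algebra_simps)
  then show ?thesis unfolding der_app_L by (simp only: const) (simp add: nabla_def)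
qed

text \<open>Differentiating \<open>\<theta>0 (L H) = (L H)^m0 g\<close> gives a multiple of
  \<open>(L H)^(m0 - 1) \<theta>(L H)\<close> and a multiple of \<open>(L H)^m0\<close>. The latter
  is divisible enough because \<open>m H \<le> 1\<close>.\<close>

lemma nabla_in_D:
  assumes \<theta>0: "\<theta>0 \<in> D A \<alpha> m0" and pos: "\<forall>H\<in>A. m0 H > 0" and m: "\<forall>H\<in>A. m H \<in> {1, 0}"
    and \<theta>: "\<theta> \<in> D A \<alpha> m"
  shows "nabla \<theta> \<theta>0 \<in> D A \<alpha> (\<lambda>H. m0 H + m H - 1)"
  unfolding D_def
proof safe
  fix H assume H: "H \<in> A"
  obtain g where g: "der_app \<theta>0 (L H) = L H ^ m0 H * g"
    using \<theta>0 H by (auto simp: D_def elim: dvdE)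
  then have eq: "der_app (nabla \<theta> \<theta>0) (L H) =
      of_nat (m0 H) * g * (L H ^ (m0 H - 1) * der_app \<theta> (L H)) + L H ^ m0 H * der_app \<theta> g"
    using pos H unfolding der_app_nabla_L g
    by (subst der_app_power_mult) (simp_all add: mult_ac)
  have "L H ^ m H dvd der_app \<theta> (L H)" using \<theta> H by (simp add: D_def)
  then have "L H ^ (m0 H - 1) * L H ^ m H dvd L H ^ (m0 H - 1) * der_app \<theta> (L H)"
    by (rule mult_dvd_mono[OF dvd_refl])
  moreover have "m0 H - 1 + m H = m0 H + m H - 1" using pos H by (simp add: Suc_leI)
  ultimately have "L H ^ (m0 H + m H - 1) dvd L H ^ (m0 H - 1) * der_app \<theta> (L H)"
    by (simp only: power_add[symmetric])
  then have "L H ^ (m0 H + m H - 1) dvd of_nat (m0 H) * g * (L H ^ (m0 H - 1) * der_app \<theta> (L H))"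
    by (rule dvd_mult)
  moreover have "L H ^ (m0 H + m H - 1) dvd L H ^ m0 H * der_app \<theta> g"
    using m H by (intro dvd_mult2 le_imp_power_dvd) auto
  ultimately show "L H ^ (m0 H + m H - 1) dvd der_app (nabla \<theta> \<theta>0) (L H)"
    unfolding eq by (rule dvd_add)
qed

text \<open>If \<open>L H\<close> divided \<open>\<theta>0(L H) / (L H)^m0\<close>, then \<open>(L H)^m0\<close> would divide the Jacobian
  determinant, which has only the factor \<open>(L H)^(m0 - 1)\<close>.\<close>

lemma in_D_if_nabla_in_D:
  assumes \<theta>0: "\<theta>0 \<in> D A \<alpha> m0" and pos: "\<forall>H\<in>A. m0 H > 0" and m: "\<forall>H\<in>A. m H \<in> {1, 0}"
    and jac: "jac \<theta>0 dvd Q (\<lambda>H. m0 H - 1)"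
    and \<theta>: "nabla \<theta> \<theta>0 \<in> D A \<alpha> (\<lambda>H. m0 H + m H - 1)"
  shows "\<theta> \<in> D A \<alpha> m"
  unfolding D_def
proof safe
  fix H assume H: "H \<in> A"
  show "L H ^ m H dvd der_app \<theta> (L H)"
  proof (cases "m H = 0")
    case False
    then have mH: "m H = 1" using m H by auto
    obtain k where k: "m0 H = Suc k" using pos H by (metis not0_implies_Suc not_gr_zero)
    have "L H ^ m0 H dvd der_app \<theta>0 (L H)" using \<theta>0 H by (simp add: D_def)
    then obtain g where g: "der_app \<theta>0 (L H) = L H ^ Suc k * g" unfolding k by (elim dvdE)
    have Lk: "L H ^ k \<noteq> 0" using prime_elem_L[OF H] prime_elem_not_zeroI by auto
    have "\<not> L H dvd g"
    proof
      assume "L H dvd g"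
      then obtain g' where "g = L H * g'" by (elim dvdE)
      with g have g': "der_app \<theta>0 (L H) = L H ^ Suc (Suc k) * g'"
        by (simp only: power_Suc2 mult.assoc)
      have "der_app (nabla \<psi> \<theta>0) (L H) = L H ^ Suc k *
          (of_nat (Suc (Suc k)) * der_app \<psi> (L H) * g' + L H * der_app \<psi> g')" for \<psi>
        unfolding der_app_nabla_L g' der_app_mult der_app_power
        by (simp only: power_Suc distrib_left mult_ac)
      then have "L H ^ Suc k dvd der_app (nabla \<psi> \<theta>0) (L H)" for \<psi>
        by (simp only: dvd_triv_left)
      then have "L H ^ Suc k dvd jac \<theta>0"
        unfolding jac_eq_det2 using L_power_dvd_det2[OF H] by blast
      then have "L H ^ Suc k dvd Q (\<lambda>H. m0 H - 1)" using jac by (rule dvd_trans)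
      then have "L H ^ Suc k dvd L H ^ k * (\<Prod>K\<in>A - {H}. L K ^ (m0 K - 1))"
        unfolding Q_remove[OF H, of "\<lambda>H. m0 H - 1"] k diff_Suc_1 .
      then have "L H dvd (\<Prod>K\<in>A - {H}. L K ^ (m0 K - 1))"
        unfolding power_Suc2 using Lk by (simp only: dvd_mult_cancel_left simp_thms)
      then show False using L_not_dvd_prod[OF H, of "\<lambda>K. m0 K - 1"] by blast
    qed
    have eq: "der_app (nabla \<theta> \<theta>0) (L H) = L H ^ k * (of_nat (Suc k) * (der_app \<theta> (L H) * g))
        + L H ^ Suc k * der_app \<theta> g"
      unfolding der_app_nabla_L g der_app_mult der_app_power by (simp only: mult_ac)
    have "L H ^ Suc k dvd der_app (nabla \<theta> \<theta>0) (L H)"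
    proof -
      have "L H ^ (m0 H + m H - 1) dvd der_app (nabla \<theta> \<theta>0) (L H)"
        using \<theta> H by (simp add: D_def)
      moreover have "m0 H + m H - 1 = Suc k" using k mH by simp
      ultimately show ?thesis by (simp only:)
    qed
    \<comment> \<open>Modulo \<open>L H ^ Suc k\<close> only the first summand remains. The scalar
      \<open>Suc k\<close> is a unit in characteristic zero.\<close>
    then have "L H ^ k * L H dvd L H ^ k * (of_nat (Suc k) * (der_app \<theta> (L H) * g))"
      unfolding eq by (simp only: dvd_add_left_iff dvd_triv_left power_Suc2)
    then have "L H dvd [:[:of_nat (Suc k):]:] * (der_app \<theta> (L H) * g)"
      using Lk by (simp only: dvd_mult_cancel_left simp_thms of_nat_poly)
    then have "L H dvd der_app \<theta> (L H) * g"
      by (subst (asm) dvd_const_mult_iff) (simp_all del: of_nat_Suc)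
    then show ?thesis
      using prime_elem_dvd_multD[OF prime_elem_L[OF H]] \<open>\<not> L H dvd g\<close>
      unfolding mH power_one_right by blast
  qed simp
qed

text \<open>A nonzero Jacobian gives injectivity. For surjectivity, the images of the coordinate
  derivations generate \<open>D(A, m0 - 1)\<close>, and \<open>in_D_if_nabla_in_D\<close> puts the
  preimage into \<open>D(A, m)\<close>.\<close>

lemma nabla_iso:
  assumes \<theta>0: "\<theta>0 \<in> D A \<alpha> m0" and pos: "\<forall>H\<in>A. m0 H > 0" and m: "\<forall>H\<in>A. m H \<in> {1, 0}"
    and jac: "jac \<theta>0 dvd Q (\<lambda>H. m0 H - 1)"
  shows "S_module_iso (D A \<alpha> m) (D A \<alpha> (\<lambda>H. m0 H + m H - 1)) (\<lambda>\<theta>. nabla \<theta> \<theta>0)"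
  unfolding S_module_iso_def
proof (intro conjI subspace_D ballI allI nabla_add nabla_scale bij_betwI')
  have J: "jac \<theta>0 \<noteq> 0" using jac prod_L_nonzero[of A] by auto
  show "nabla \<theta> \<theta>0 = nabla \<phi> \<theta>0 \<longleftrightarrow> \<theta> = \<phi>" for \<theta> \<phi>
    using nabla_inj[OF J] by auto
  show "nabla \<theta> \<theta>0 \<in> D A \<alpha> (\<lambda>H. m0 H + m H - 1)" if "\<theta> \<in> D A \<alpha> m" for \<theta>
    using nabla_in_D[OF \<theta>0 pos m that] .
  show "\<exists>\<theta>\<in>D A \<alpha> m. \<eta> = nabla \<theta> \<theta>0" if \<eta>: "\<eta> \<in> D A \<alpha> (\<lambda>H. m0 H + m H - 1)" for \<eta>
  proof -
    define X where "X = nabla (vector [1, 0]) \<theta>0"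
    define Y where "Y = nabla (vector [0, 1]) \<theta>0"
    \<comment> \<open>The zero multiplicity imposes no condition on \<open>\<psi>\<close>.\<close>
    have "nabla \<psi> \<theta>0 \<in> D A \<alpha> (\<lambda>H. m0 H - 1)" for \<psi>
      using nabla_in_D[OF \<theta>0 pos, of "\<lambda>_. 0" \<psi>] by (simp add: D_def)
    then have XY: "X \<in> D A \<alpha> (\<lambda>H. m0 H - 1)" "Y \<in> D A \<alpha> (\<lambda>H. m0 H - 1)"
      by (simp_all add: X_def Y_def)
    have "\<eta> \<in> D A \<alpha> (\<lambda>H. m0 H - 1)"
      unfolding D_def
    proof safe
      fix H assume "H \<in> A"
      then have "L H ^ (m0 H + m H - 1) dvd der_app \<eta> (L H)" using \<eta> by (simp add: D_def)
      then show "L H ^ (m0 H - 1) dvd der_app \<eta> (L H)"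
        by (rule dvd_trans[OF le_imp_power_dvd, rotated]) simp
    qed
    \<comment> \<open>\<open>det2 X Y\<close> is \<open>jac \<theta>0\<close>, which divides
      \<open>Q (m0 - 1)\<close> and so every determinant from \<open>D(A, m0 - 1)\<close>. Cramer's
      coefficients are therefore polynomials.\<close>
    then have "det2 X Y dvd det2 \<eta> Y" "det2 X Y dvd det2 X \<eta>"
      using XY Q_dvd_det2 dvd_trans[OF jac] by (simp_all add: X_def Y_def jac_eq_det2)
    then obtain p q where pq: "det2 \<eta> Y = det2 X Y * p" "det2 X \<eta> = det2 X Y * q"
      by (metis dvdE)
    then have "\<eta> = p *s X + q *s Y"
      using J by (intro cramer) (simp_all add: X_def Y_def jac_eq_det2)
    also have "\<dots> = nabla (vector [p, q]) \<theta>0"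
      by (simp add: X_def Y_def vec2_eq_iff nabla_def der_app_def)
    finally have eq: "\<eta> = nabla (vector [p, q]) \<theta>0" .
    then show ?thesis using in_D_if_nabla_in_D[OF \<theta>0 pos m jac] \<eta> by blast
  qed
qed

lemma jac_nonzero:
  assumes \<theta>0: "\<theta>0 \<in> D A \<alpha> m0" and hom: "homogeneous_der a \<theta>0" and "a > 0"
    and less: "\<And>K. K \<in> A \<Longrightarrow> a < sum m0 (A - {K})" and "A \<noteq> {}"
  shows "jac \<theta>0 \<noteq> 0"
proof
  assume "jac \<theta>0 = 0"
  then have "d1 (\<theta>0 $ 1) * d2 (\<theta>0 $ 2) = d2 (\<theta>0 $ 1) * d1 (\<theta>0 $ 2)" by (simp add: jac_def)
  then obtain p u v where p: "homogeneous_poly a p" "p \<noteq> 0" and uv: "u \<noteq> 0 \<or> v \<noteq> 0"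
    and \<theta>0_eq: "\<theta>0 $ 1 = [:[:u:]:] * p" "\<theta>0 $ 2 = [:[:v:]:] * p"
    using det_jacobian_zero_imp_proportional[OF hom \<open>a > 0\<close>] by blast
  \<comment> \<open>The value of the form on the constant vector \<open>(u, v)\<close>, so that
    \<open>\<theta>0 (L H) = val H p\<close>.\<close>
  define val where "val H = \<alpha> H (axis 1 1) * u + \<alpha> H (axis 2 1) * v" for H
  have val_unique: "H = K" if "H \<in> A" "K \<in> A" "val H = 0" "val K = 0" for H K
  proof (rule ccontr)
    assume "H \<noteq> K"
    \<comment> \<open>The determinant of the two forms: by Cramer's rule, a nonzero vector killed by
      both would force \<open>e = 0\<close>.\<close>
    define e where "e = \<alpha> H (axis 1 1) * \<alpha> K (axis 2 1) - \<alpha> K (axis 1 1) * \<alpha> H (axis 2 1)"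
    have "e * u = \<alpha> K (axis 2 1) * val H - \<alpha> H (axis 2 1) * val K"
      "e * v = \<alpha> H (axis 1 1) * val K - \<alpha> K (axis 1 1) * val H"
      by (simp_all add: e_def val_def algebra_simps)
    moreover have "e \<noteq> 0" using independent[OF that(1,2) \<open>H \<noteq> K\<close>] by (simp add: e_def)
    ultimately show False using uv that by auto
  qed
  \<comment> \<open>\<open>K\<close> is the line whose form vanishes at \<open>(u, v)\<close>, if
    there is one, and arbitrary otherwise.\<close>
  obtain K where K: "K \<in> A" "\<forall>H\<in>A - {K}. val H \<noteq> 0"
  proof (cases "\<exists>K\<in>A. val K = 0")
    case True
    then obtain K0 where "K0 \<in> A" "val K0 = 0" by blast
    then show ?thesis using val_unique by (intro that[of K0]) auto
  next
    case False
    moreover obtain K0 where "K0 \<in> A" using \<open>A \<noteq> {}\<close> by blast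
    ultimately show ?thesis by (intro that[of K0]) auto
  qed
  have "L H ^ m0 H dvd p" if "H \<in> A - {K}" for H
  proof -
    have "[:[:x:]:] * ([:[:u:]:] * p) + [:[:y:]:] * ([:[:v:]:] * p) = [:[:x * u + y * v:]:] * p" for x y
      by (simp flip: smult_add_left)
    then have "der_app \<theta>0 (L H) = [:[:val H:]:] * p"
      unfolding der_app_L \<theta>0_eq val_def by blast
    then have "L H ^ m0 H dvd [:[:val H:]:] * p" using \<theta>0 that by (auto simp: D_def)
    then show ?thesis using dvd_const_mult_iff[of "val H"] K(2) that by blast
  qed
  then have "(\<Prod>H\<in>A - {K}. L H ^ m0 H) dvd p" by (intro prod_L_dvd) auto
  then obtain g where g: "p = (\<Prod>H\<in>A - {K}. L H ^ m0 H) * g" by (elim dvdE)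
  obtain l where "a = sum m0 (A - {K}) + l" "homogeneous_poly l g"
    using p unfolding g by (rule homogeneous_quotient[OF _ homogeneous_prod_L[OF Diff_subset]])
  then show False using less[OF K(1)] by simp
qed

text \<open>\<open>Q (m0 - 1)\<close> divides the Jacobian. By \<open>deg\<close> both have the same
  degree, so the cofactor is a nonzero constant and the divisibility reverses.\<close>

lemma jac_dvd_Q:
  assumes \<theta>0: "\<theta>0 \<in> D A \<alpha> m0" and hom: "homogeneous_der a \<theta>0" and pos: "\<forall>H\<in>A. m0 H > 0"
    and J: "jac \<theta>0 \<noteq> 0" and deg: "2 * (a - 1) = (\<Sum>H\<in>A. m0 H - 1)"
  shows "jac \<theta>0 dvd Q (\<lambda>H. m0 H - 1)"
proof -
  have "nabla \<psi> \<theta>0 \<in> D A \<alpha> (\<lambda>H. m0 H - 1)" for \<psi>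
    using nabla_in_D[OF \<theta>0 pos, of "\<lambda>_. 0" \<psi>] by (simp add: D_def)
  then have "Q (\<lambda>H. m0 H - 1) dvd jac \<theta>0"
    unfolding jac_eq_det2 by (intro Q_dvd_det2)
  then obtain c where c: "jac \<theta>0 = Q (\<lambda>H. m0 H - 1) * c" by (elim dvdE)
  have "homogeneous_poly ((a - 1) + (a - 1)) (jac \<theta>0)"
    using hom unfolding jac_def homogeneous_der_def
    by (intro homogeneous_diff homogeneous_mult homogeneous_d1 homogeneous_d2) auto
  then have "homogeneous_poly (\<Sum>H\<in>A. m0 H - 1) (Q (\<lambda>H. m0 H - 1) * c)"
    unfolding deg[symmetric] mult_2 c .
  then obtain l where "(\<Sum>H\<in>A. m0 H - 1) = (\<Sum>H\<in>A. m0 H - 1) + l" "homogeneous_poly l c"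
    using J unfolding c by (rule homogeneous_quotient[OF _ homogeneous_prod_L[OF subset_refl]])
  then have "homogeneous_poly 0 c" by simp
  then obtain x where x: "c = [:[:x:]:]" using homogeneous_0_const by blast
  then have "x \<noteq> 0" using J c by auto
  then have "is_unit c" unfolding x by (simp add: is_unit_const_poly_iff dvd_field_iff)
  then show ?thesis unfolding c by (simp only: mult_unit_dvd_iff dvd_refl)
qed

end

section \<open>From arrangements to linear forms, and the isomorphism\<close>

lemma linear_forms_if_defining_forms:
  assumes arr: "central_arrangement A" and forms: "defining_forms A \<alpha>"
  shows "linear_forms A \<alpha>"
proof
  have eval: "\<alpha> H v = v $ 1 * \<alpha> H (axis 1 1) + v $ 2 * \<alpha> H (axis 2 1)" if "H \<in> A" for H v
  proof -
    interpret l: Vector_Spaces.linear "(*s)" "(*)" "\<alpha> H"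
      using forms that unfolding defining_forms_def by blast
    have "v = v $ 1 *s axis 1 1 + v $ 2 *s axis 2 1"
      by (simp add: vec2_eq_iff axis_def)
    then have "\<alpha> H v = \<alpha> H (v $ 1 *s axis 1 1 + v $ 2 *s axis 2 1)" by (rule arg_cong)
    then show ?thesis by (simp only: l.add l.scale)
  qed
  have kernel: "H = {v. v $ 1 * \<alpha> H (axis 1 1) + v $ 2 * \<alpha> H (axis 2 1) = 0}" if "H \<in> A" for H
  proof -
    have "v \<in> H \<longleftrightarrow> \<alpha> H v = 0" for v
      using forms that unfolding defining_forms_def by blast
    then have "v \<in> H \<longleftrightarrow> v $ 1 * \<alpha> H (axis 1 1) + v $ 2 * \<alpha> H (axis 2 1) = 0" for v
      by (simp only: eval[OF that, of v, symmetric])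
    then show ?thesis by blast
  qed
  show "finite A" using arr by (simp add: central_arrangement_def)
  show nz: "\<alpha> H (axis 1 1) \<noteq> 0 \<or> \<alpha> H (axis 2 1) \<noteq> 0" if "H \<in> A" for H
  proof (rule ccontr)
    assume "\<not> ?thesis"
    \<comment> \<open>A zero form would have the whole plane as kernel, of dimension 2 instead of
      1.\<close>
    then have "v $ 1 * \<alpha> H (axis 1 1) + v $ 2 * \<alpha> H (axis 2 1) = 0" for v :: "'a ^ 2"
      by simp
    then have "v \<in> H" for v using kernel[OF that] by blast
    then have "H = UNIV" by blast
    then have "vec.dim H = 2" by (simp add: vec_dim_card card_cart_basis)
    then show False using arr that by (simp add: central_arrangement_def)
  qed
  show "\<alpha> H (axis 1 1) * \<alpha> K (axis 2 1) \<noteq> \<alpha> K (axis 1 1) * \<alpha> H (axis 2 1)"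
    if "H \<in> A" "K \<in> A" "H \<noteq> K" for H K
  proof
    assume eq: "\<alpha> H (axis 1 1) * \<alpha> K (axis 2 1) = \<alpha> K (axis 1 1) * \<alpha> H (axis 2 1)"
    \<comment> \<open>Nonzero proportional forms have the same zeros; used in both directions, this
      gives \<open>H = K\<close>.\<close>
    have same: "x * c + y * d = 0"
      if "a * d = c * b" "a \<noteq> 0 \<or> b \<noteq> 0" "x * a + y * b = 0" for a b c d x y :: 'a
    proof -
      have "a * (x * c + y * d) = c * (x * a + y * b) + y * (a * d - c * b)"
        "b * (x * c + y * d) = d * (x * a + y * b) + x * (c * b - a * d)"
        by (simp_all add: algebra_simps)
      then show ?thesis using that by auto
    qed
    have "H = K"
      using kernel[OF that(1)] kernel[OF that(2)]
        same[OF eq nz[OF that(1)]] same[OF eq[symmetric] nz[OF that(2)]] by blast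
    then show False using that(3) by simp
  qed
qed

theorem theorem0p2:
  fixes A :: "('a::field_char_0 ^ 2) set set"
    and \<alpha> :: "('a ^ 2) set \<Rightarrow> 'a ^ 2 \<Rightarrow> 'a"
    and m0 :: "('a ^ 2) set \<Rightarrow> nat"
    and h :: nat
    and \<theta>0 :: "'a Der"
  assumes arr: "central_arrangement A"
    and forms: "defining_forms A \<alpha>"
    and card_A: "card A = h" and h_gt: "h > 2"
    and m0_pos: "\<forall>H\<in>A. m0 H > 0"
    and m0_balanced: "balanced A m0"
    and Delta_m0: "Delta A \<alpha> m0 = int h - 2"
    and cases: "(h = 3 \<and> balanced A (\<lambda>H. m0 H - 1)) \<or> h \<ge> 4"
    and theta0: "lower_degree_basis A \<alpha> m0 \<theta>0"
  shows "\<forall>m :: ('a ^ 2) set \<Rightarrow> nat. (\<forall>H\<in>A. m H \<in> {1, 0}) \<longrightarrow>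
    S_module_iso (D A \<alpha> m) (D A \<alpha> (\<lambda>H. m0 H + m H - 1)) (\<lambda>\<theta>. nabla \<theta> \<theta>0)"
proof (intro allI impI)
  fix m :: "('a ^ 2) set \<Rightarrow> nat" assume m: "\<forall>H\<in>A. m H \<in> {1, 0}"
  interpret linear_forms A \<alpha> using arr forms by (rule linear_forms_if_defining_forms)
  obtain \<phi> a b where basis: "is_basis (D A \<alpha> m0) \<theta>0 \<phi>"
    and hom: "homogeneous_der a \<theta>0" "homogeneous_der b \<phi>" and "a \<le> b"
    using theta0 by (auto simp: lower_degree_basis_def)
  have \<theta>0: "\<theta>0 \<in> D A \<alpha> m0"
    using basis by (auto simp: is_basis_def intro: der.span_base)
  have ne: "A \<noteq> {}" using card_A h_gt by auto
  have sum: "a + b = sum m0 A" using basis hom ne by (rule sum_exponents)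
  have "exponents A \<alpha> m0 a b" using basis hom by (auto simp: exponents_def)
  then have diff: "int b - int a = int h - 2"
    using Delta_eq[OF _ \<open>a \<le> b\<close> ne] Delta_m0 by simp
  have pred_sum: "(\<Sum>H\<in>A. m0 H - 1) + h = sum m0 A"
  proof -
    have "(\<Sum>H\<in>A. m0 H - 1) + h = (\<Sum>H\<in>A. (m0 H - 1) + 1)"
      unfolding sum.distrib using card_A by simp
    also have "\<dots> = sum m0 A" using m0_pos by (intro sum.cong) auto
    finally show ?thesis .
  qed
  \<comment> \<open>Here \<open>2 a = |m0| - (h - 2) = |m0 - 1| + 2\<close>.\<close>
  have "a > 0" using sum diff pred_sum by linarith
  \<comment> \<open>Since \<open>h > 2\<close>, \<open>2 a < |m0|\<close>, and by balancedness
    \<open>|m0|\<close> is at most twice the sum over the other lines.\<close>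
  moreover have "a < sum m0 (A - {K})" if "K \<in> A" for K
  proof -
    have "sum m0 A = m0 K + sum m0 (A - {K})" using finite_A that by (rule sum.remove)
    moreover have "m0 K \<le> sum m0 (A - {K})" using m0_balanced that by (simp add: balanced_def)
    ultimately show ?thesis using sum diff h_gt by linarith
  qed
  ultimately have "jac \<theta>0 \<noteq> 0" using jac_nonzero[OF \<theta>0 hom(1)] ne by blast
  moreover have "2 * (a - 1) = (\<Sum>H\<in>A. m0 H - 1)"
    using sum diff pred_sum \<open>a > 0\<close> by linarith
  ultimately have "jac \<theta>0 dvd Q (\<lambda>H. m0 H - 1)"
    using jac_dvd_Q[OF \<theta>0 hom(1) m0_pos] by blast
  with \<theta>0 m0_pos m show "S_module_iso (D A \<alpha> m) (D A \<alpha> (\<lambda>H. m0 H + m H - 1)) (\<lambda>\<theta>. nabla \<theta> \<theta>0)"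
    by (rule nabla_iso)
qed

end
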